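(* Let $\mu(n)=\frac{\pi}{6}\sqrt{24n-1}$. For an integer $n$, set $x=\mu(n-1)$, $y=\mu(n)$, $z=\mu(n+1)$ and define $$f(n)=e^{x-2y+z}\,\frac{(x^{10}-x^9-1)\,y^{24}\,(z^{10}-z^9-1)}{x^{12}\,(y^{10}-y^9+1)^2\,z^{12}},\qquad g(n)=e^{x-2y+z}\,\frac{(x^{10}-x^9+1)\,y^{24}\,(z^{10}-z^9+1)}{x^{12}\,(y^{10}-y^9-1)^2\,z^{12}}.$$ Then for all integers $n\geq 2$, $$g(n+1)<f(n)+\frac{110}{\mu(n-1)^5}.$$ *)

theory Defs
  imports Complex_Main
begin

definition mu :: "int \<Rightarrow> real" where
  "mu n = pi / 6 * sqrt (24 * real_of_int n - 1)"

definition f :: "int \<Rightarrow> real" where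
  "f n = (let x = mu (n - 1); y = mu n; z = mu (n + 1) in
     exp (x - 2 * y + z) *
       (((x ^ 10 - x ^ 9 - 1) * y ^ 24 * (z ^ 10 - z ^ 9 - 1)) /
        (x ^ 12 * (y ^ 10 - y ^ 9 + 1) ^ 2 * z ^ 12)))"

definition g :: "int \<Rightarrow> real" where
  "g n = (let x = mu (n - 1); y = mu n; z = mu (n + 1) in
     exp (x - 2 * y + z) *
       (((x ^ 10 - x ^ 9 + 1) * y ^ 24 * (z ^ 10 - z ^ 9 + 1)) /
        (x ^ 12 * (y ^ 10 - y ^ 9 - 1) ^ 2 * z ^ 12)))"

end

theory Submission
  imports Defs "HOL-Analysis.Complex_Transcendental"
begin

text \<open>
  Up to terms of relative size \<open>O(t\<^sup>-\<^sup>1\<^sup>0)\<close>, both \<open>f\<close> and \<open>g\<close> are second-order ratios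
  \<open>F(x) F(z) / F(y)\<^sup>2\<close> of \<open>F(t) = e\<^sup>t (t - 1) / t\<^sup>3\<close> at values of \<open>\<mu>\<close>, and the squares \<open>\<mu>(n)\<^sup>2\<close> form
  an arithmetic progression with difference \<open>a = 2\<pi>\<^sup>2/3\<close>. As a function of \<open>u = t\<^sup>2\<close>,
  \<open>ln F(t) = t + ln (t - 1) - 3 ln t\<close> is concave, whence \<open>f(n) \<le> 1\<close>. The third difference of
  \<open>ln (t - 1) - 3 ln t\<close> is nonpositive, so with \<open>x = \<mu>(n - 1)\<close> the logarithm of \<open>g(n + 1) / f(n)\<close> is
  at most the third difference of the square root plus a small correction. That difference is at most
  \<open>(3/8) a\<^sup>3 / (x\<^sup>5 + 3 a x\<^sup>3) < 107 / (x\<^sup>5 + 110)\<close>, and the sum is less than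
  \<open>110 / (x\<^sup>5 + 110) \<le> ln (1 + 110 / x\<^sup>5)\<close>.
\<close>

subsection \<open>Forward differences\<close>

definition forward_difference :: "'a::plus \<Rightarrow> ('a \<Rightarrow> 'b::minus) \<Rightarrow> 'a \<Rightarrow> 'b" where
  "forward_difference a k u = k (u + a) - k u"

lemma second_forward_difference:
  fixes k :: "'a::comm_ring_1 \<Rightarrow> 'b::comm_ring_1"
  shows "(forward_difference a ^^ 2) k u = k (u + 2 * a) - 2 * k (u + a) + k u"
proof -
  have shift: "u + 2 * a = u + a + a" by simp
  show ?thesis
    unfolding shift by (simp add: forward_difference_def eval_nat_numeral)
qed

lemma third_forward_difference:
  fixes k :: "'a::comm_ring_1 \<Rightarrow> 'b::comm_ring_1"
  shows "(forward_difference a ^^ 3) k u =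
    k (u + 3 * a) - 3 * k (u + 2 * a) + 3 * k (u + a) - k u"
proof -
  have shifts: "u + 3 * a = u + a + a + a" "u + 2 * a = u + a + a" by simp_all
  show ?thesis
    unfolding shifts by (simp add: forward_difference_def eval_nat_numeral)
qed

lemma funpow_forward_difference_nonpos:
  fixes diff :: "nat \<Rightarrow> real \<Rightarrow> real"
  assumes "a \<ge> 0"
    and "\<And>m u. m < n \<Longrightarrow> u \<ge> s \<Longrightarrow>
      (diff m has_real_derivative diff (Suc m) u) (at u)"
    and "\<And>u. u \<ge> s \<Longrightarrow> diff n u \<le> 0"
  shows "(forward_difference a ^^ n) (diff 0) s \<le> 0"
  using assms(2,3)
proof (induction n arbitrary: diff)
  case 0
  then show ?case by simp
next
  case (Suc n)
  have "(forward_difference a ^^ n) (forward_difference a (diff 0)) s \<le> 0"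
  proof (rule Suc.IH[of "\<lambda>m. forward_difference a (diff m)"])
    fix m u
    assume "m < n" "u \<ge> s"
    then have "(diff m has_real_derivative diff (Suc m) (u + a)) (at (u + a))"
      "(diff m has_real_derivative diff (Suc m) u) (at u)"
      using \<open>a \<ge> 0\<close> by (auto intro: Suc.prems(1))
    then show "(forward_difference a (diff m) has_real_derivative
        forward_difference a (diff (Suc m)) u) (at u)"
      unfolding forward_difference_def by (intro DERIV_diff) (simp_all add: DERIV_shift)
  next
    fix u
    assume "u \<ge> s"
    have "diff n (u + a) \<le> diff n u"
    proof (rule DERIV_nonpos_imp_nonincreasing[of u "u + a" "diff n"])
      fix v
      assume "u \<le> v"
      then show "\<exists>D. (diff n has_real_derivative D) (at v) \<and> D \<le> 0"
        using Suc.prems(1)[of n v] Suc.prems(2)[of v] \<open>u \<ge> s\<close> by auto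
    qed (use \<open>a \<ge> 0\<close> in simp)
    then show "forward_difference a (diff n) u \<le> 0"
      by (simp add: forward_difference_def)
  qed
  then show ?case
    by (simp add: funpow_Suc_right del: funpow.simps)
qed

subsection \<open>Differences of the square root\<close>

lemma second_forward_difference_sqrt:
  fixes s a :: real
  assumes "s > 0" "a \<ge> 0"
  defines "x \<equiv> sqrt s" and "y \<equiv> sqrt (s + a)" and "z \<equiv> sqrt (s + 2 * a)"
  shows "(forward_difference a ^^ 2) sqrt s = - 2 * a\<^sup>2 / ((x + y) * (y + z) * (x + z))"
proof -
  have pos: "x > 0" "y > 0" "z > 0"
    using assms by simp_all
  have sq: "y\<^sup>2 = x\<^sup>2 + a" "z\<^sup>2 = x\<^sup>2 + 2 * a"
    using assms by simp_all
  have steps: "y - x = a / (x + y)" "z - y = a / (y + z)" "z - x = 2 * a / (x + z)"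
    using pos sq by (simp_all add: field_simps power2_eq_square)
  have "(forward_difference a ^^ 2) sqrt s = (z - y) - (y - x)"
    by (simp add: second_forward_difference x_def y_def z_def)
  also have "\<dots> = a / (y + z) - a / (x + y)"
    using steps by simp
  also have "\<dots> = - a * (z - x) / ((x + y) * (y + z))"
    using pos by (simp add: field_simps)
  finally show ?thesis
    unfolding steps(3) by (simp add: power2_eq_square mult_ac)
qed

lemma third_forward_difference_sqrt:
  fixes s a :: real
  assumes "s > 0" "a \<ge> 0"
  defines "x \<equiv> sqrt s" and "y \<equiv> sqrt (s + a)"
    and "z \<equiv> sqrt (s + 2 * a)" and "w \<equiv> sqrt (s + 3 * a)"
  shows "(forward_difference a ^^ 3) sqrt s =
    6 * a ^ 3 * (1 / (x + w) + 1 / (y + z)) / ((x + y) * (x + z) * (y + w) * (z + w))"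
proof -
  have pos: "x > 0" "y > 0" "z > 0" "w > 0"
    using assms by simp_all
  have "w\<^sup>2 = x\<^sup>2 + 3 * a"
    using assms by simp
  then have wx: "w - x = 3 * a / (x + w)"
    using pos by (simp add: field_simps power2_eq_square)
  have shifts: "s + a + 2 * a = s + 3 * a" "s + a + a = s + 2 * a" by simp_all
  have "(forward_difference a ^^ 3) sqrt s =
      (forward_difference a ^^ 2) sqrt (s + a) - (forward_difference a ^^ 2) sqrt s"
    unfolding second_forward_difference third_forward_difference shifts by simp
  also have "\<dots> = 2 * a\<^sup>2 / ((x + y) * (y + z) * (x + z)) -
      2 * a\<^sup>2 / ((y + z) * (z + w) * (y + w))"
    using second_forward_difference_sqrt[of s a] second_forward_difference_sqrt[of "s + a" a] assms
    unfolding shifts by simp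
  also have "\<dots> = 2 * a\<^sup>2 * ((w - x) * ((x + w) + (y + z)) / (y + z)) /
      ((x + y) * (x + z) * (y + w) * (z + w))"
    using pos by (simp add: divide_simps) (simp add: algebra_simps)
  also have "(w - x) * ((x + w) + (y + z)) / (y + z) = 3 * a * (1 / (x + w) + 1 / (y + z))"
    unfolding wx using pos by (simp add: divide_simps)
  finally show ?thesis
    by (simp add: power2_eq_square power3_eq_cube mult.assoc)
qed

lemma am_gm_four_pair_sums:
  fixes x y z w :: real
  assumes "x \<ge> 0" "y \<ge> 0" "z \<ge> 0" "w \<ge> 0"
  shows "16 * (x * y * z * w) \<le> (x + y) * (x + z) * (y + w) * (z + w)"
proof (rule power2_le_imp_le)
  have am_gm: "4 * (u * v) \<le> (u + v)\<^sup>2" for u v :: real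
    using zero_le_power2[of "u - v"] by (simp add: power2_eq_square algebra_simps)
  have "(16 * (x * y * z * w))\<^sup>2 = 4 * (x * y) * (4 * (x * z)) * (4 * (y * w)) * (4 * (z * w))"
    by (simp add: power2_eq_square)
  also have "\<dots> \<le> (x + y)\<^sup>2 * (x + z)\<^sup>2 * (y + w)\<^sup>2 * (z + w)\<^sup>2"
    using assms by (intro mult_mono am_gm) auto
  also have "\<dots> = ((x + y) * (x + z) * (y + w) * (z + w))\<^sup>2"
    by (simp add: power_mult_distrib)
  finally show "(16 * (x * y * z * w))\<^sup>2 \<le> ((x + y) * (x + z) * (y + w) * (z + w))\<^sup>2" .
qed (use assms in simp)

lemma third_forward_difference_sqrt_le:
  fixes s a :: real
  assumes "s > 0" "a \<ge> 0"
  defines "x \<equiv> sqrt s"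
  shows "(forward_difference a ^^ 3) sqrt s \<le> 3 / 8 * a ^ 3 / (x ^ 5 + 3 * a * x ^ 3)"
proof -
  define y z w where "y = sqrt (s + a)" and "z = sqrt (s + 2 * a)" and "w = sqrt (s + 3 * a)"
  have ge: "x \<le> y" "x \<le> z" "x \<le> w" "x > 0"
    using assms by (simp_all add: y_def z_def w_def)
  have sq: "y\<^sup>2 = x\<^sup>2 + a" "z\<^sup>2 = x\<^sup>2 + 2 * a" "w\<^sup>2 = x\<^sup>2 + 3 * a"
    using assms by (simp_all add: y_def z_def w_def)
  have "(x ^ 3 + 3 * a * x)\<^sup>2 \<le> y\<^sup>2 * z\<^sup>2 * w\<^sup>2"
    unfolding sq using assms(2) ge
    by (simp add: algebra_simps eval_nat_numeral)
  then have "x ^ 3 + 3 * a * x \<le> y * z * w"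
    using ge by (intro power2_le_imp_le[of "x ^ 3 + 3 * a * x"]) (simp_all add: power_mult_distrib)
  then have "x\<^sup>2 * (x ^ 3 + 3 * a * x) \<le> x\<^sup>2 * (y * z * w)"
    by (intro mult_left_mono) auto
  then have prod_ge: "x ^ 5 + 3 * a * x ^ 3 \<le> x * (x * y * z * w)"
    by (simp add: algebra_simps eval_nat_numeral)
  have "1 / (x + w) + 1 / (y + z) \<le> 1 / (2 * x) + 1 / (2 * x)"
    using ge by (intro add_mono divide_left_mono) auto
  then have "1 / (x + w) + 1 / (y + z) \<le> 1 / x"
    by simp
  then have "(forward_difference a ^^ 3) sqrt s \<le> 6 * a ^ 3 * (1 / x) / (16 * (x * y * z * w))"
    unfolding third_forward_difference_sqrt[OF assms(1,2), folded x_def y_def z_def w_def]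
    using assms(2) ge
    by (intro frac_le mult_left_mono mult_nonneg_nonneg am_gm_four_pair_sums) auto
  also have "\<dots> = 3 / 8 * a ^ 3 / (x * (x * y * z * w))"
    by simp
  also have "\<dots> \<le> 3 / 8 * a ^ 3 / (x ^ 5 + 3 * a * x ^ 3)"
    using prod_ge assms(2) ge
    by (intro divide_left_mono mult_pos_pos add_pos_nonneg) auto
  finally show ?thesis .
qed

subsection \<open>Differences of the logarithm of the main term\<close>

lemma DERIV_comp_sqrt:
  assumes "(F has_real_derivative 2 * sqrt u * D) (at (sqrt u))" "u > 0"
  shows "((\<lambda>u. F (sqrt u)) has_real_derivative D) (at u)"
  using DERIV_chain2[OF assms(1) DERIV_real_sqrt[OF assms(2)]] assms(2) by (simp add: field_simps)

lemma DERIV_divide_powers: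
  fixes r b c :: real
  assumes "(N has_real_derivative N') (at r)" "r \<noteq> 0" "r \<noteq> b" "c \<noteq> 0"
  shows "((\<lambda>r. N r / (c * r ^ p * (r - b) ^ q)) has_real_derivative
    (N' * (r * (r - b)) - N r * (p * (r - b) + q * r)) /
    (c * r ^ (p + 1) * (r - b) ^ (q + 1))) (at r)"
proof -
  define D where "D r = c * r ^ p * (r - b) ^ q" for r
  have "D r \<noteq> 0"
    using assms by (simp add: D_def)
  have pow: "n * t ^ (n - Suc 0) = n * t ^ n / t" if "t \<noteq> 0" for n and t :: real
    using that by (cases n) simp_all
  have "(D has_real_derivative
      c * (p * r ^ (p - 1)) * (r - b) ^ q + c * r ^ p * (q * (r - b) ^ (q - 1))) (at r)"
    unfolding D_def by (auto intro!: derivative_eq_intros)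
  also have "c * (p * r ^ (p - 1)) * (r - b) ^ q + c * r ^ p * (q * (r - b) ^ (q - 1)) =
      D r * (p * (r - b) + q * r) / (r * (r - b))"
    using assms(2,3) by (simp add: pow D_def divide_simps) (simp add: algebra_simps)
  finally have D': "(D has_real_derivative D r * (p * (r - b) + q * r) / (r * (r - b))) (at r)" .
  have "((\<lambda>r. N r / D r) has_real_derivative
      (N' * D r - N r * (D r * (p * (r - b) + q * r) / (r * (r - b)))) / (D r * D r)) (at r)"
    using assms(1) D' \<open>D r \<noteq> 0\<close> by (rule DERIV_divide)
  also have "(N' * D r - N r * (D r * (p * (r - b) + q * r) / (r * (r - b)))) / (D r * D r) =
      (N' * (r * (r - b)) - N r * (p * (r - b) + q * r)) / (D r * (r * (r - b)))"
    using \<open>D r \<noteq> 0\<close> assms(2,3) by (simp add: divide_simps) (simp add: algebra_simps)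
  also have "D r * (r * (r - b)) = c * r ^ (p + 1) * (r - b) ^ (q + 1)"
    by (simp add: D_def)
  finally show ?thesis
    by (simp add: D_def)
qed

text \<open>Iterated derivatives of \<open>ln ((r - 1) / r\<^sup>3)\<close> and of \<open>r\<close>, with respect to \<open>u = r\<^sup>2\<close>.\<close>

definition ln_main_deriv :: "nat \<Rightarrow> real \<Rightarrow> real" where
  "ln_main_deriv m r =
    [ln (r - 1) - 3 * ln r,
     - (2 * r - 3) / (2 * r\<^sup>2 * (r - 1) ^ 1),
     (4 * r\<^sup>2 - 11 * r + 6) / (4 * r ^ 4 * (r - 1)\<^sup>2),
     - (16 * r ^ 3 - 63 * r\<^sup>2 + 69 * r - 24) / (8 * r ^ 6 * (r - 1) ^ 3)] ! m"

definition sqrt_deriv :: "nat \<Rightarrow> real \<Rightarrow> real" where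
  "sqrt_deriv m r = [r, 1 / (2 * r), - 1 / (4 * r ^ 3)] ! m"

lemma DERIV_ln_main_deriv_1:
  assumes "r > 1"
  shows "(ln_main_deriv 1 has_real_derivative 2 * r * ln_main_deriv 2 r) (at r)"
proof -
  have "((\<lambda>r. - (2 * r - 3) / (2 * r\<^sup>2 * (r - 1) ^ 1)) has_real_derivative
      (- 2 * (r * (r - 1)) - - (2 * r - 3) * ((2::nat) * (r - 1) + (1::nat) * r)) /
      (2 * r ^ (2 + 1) * (r - 1) ^ (1 + 1))) (at r)"
    using \<open>r > 1\<close> by (intro DERIV_divide_powers) (auto intro!: derivative_eq_intros)
  moreover have "- 2 * (r * (r - 1)) - - (2 * r - 3) * ((2::nat) * (r - 1) + (1::nat) * r) =
      4 * r\<^sup>2 - 11 * r + 6"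
    by (simp add: power2_eq_square algebra_simps)
  moreover have "(4 * r\<^sup>2 - 11 * r + 6) / (2 * r ^ (2 + 1) * (r - 1) ^ (1 + 1)) =
      2 * r * ln_main_deriv 2 r"
    using \<open>r > 1\<close> by (simp add: ln_main_deriv_def divide_simps)
      (simp add: algebra_simps eval_nat_numeral)
  ultimately show ?thesis
    by (simp add: ln_main_deriv_def[abs_def])
qed

lemma DERIV_ln_main_deriv_2:
  assumes "r > 1"
  shows "(ln_main_deriv 2 has_real_derivative 2 * r * ln_main_deriv 3 r) (at r)"
proof -
  have "((\<lambda>r. (4 * r\<^sup>2 - 11 * r + 6) / (4 * r ^ 4 * (r - 1)\<^sup>2)) has_real_derivative
      ((8 * r - 11) * (r * (r - 1)) -
        (4 * r\<^sup>2 - 11 * r + 6) * ((4::nat) * (r - 1) + (2::nat) * r)) /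
      (4 * r ^ (4 + 1) * (r - 1) ^ (2 + 1))) (at r)"
    using \<open>r > 1\<close> by (intro DERIV_divide_powers) (auto intro!: derivative_eq_intros)
  moreover have "(8 * r - 11) * (r * (r - 1)) -
        (4 * r\<^sup>2 - 11 * r + 6) * ((4::nat) * (r - 1) + (2::nat) * r) =
      - (16 * r ^ 3 - 63 * r\<^sup>2 + 69 * r - 24)"
    by (simp add: power2_eq_square power3_eq_cube algebra_simps)
  moreover have "- (16 * r ^ 3 - 63 * r\<^sup>2 + 69 * r - 24) / (4 * r ^ (4 + 1) * (r - 1) ^ (2 + 1)) =
      2 * r * ln_main_deriv 3 r"
    using \<open>r > 1\<close> by (simp add: ln_main_deriv_def divide_simps)
      (simp add: algebra_simps eval_nat_numeral)
  ultimately show ?thesis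
    by (simp add: ln_main_deriv_def[abs_def])
qed

lemma DERIV_ln_main_deriv:
  assumes "m < 3" "r > 1"
  shows "(ln_main_deriv m has_real_derivative 2 * r * ln_main_deriv (Suc m) r) (at r)"
proof -
  consider "m = 0" | "m = 1" | "m = 2"
    using \<open>m < 3\<close> by linarith
  then show ?thesis
  proof cases
    case 1
    have "((\<lambda>r. ln (r - 1) - 3 * ln r) has_real_derivative 1 / (r - 1) - 3 / r) (at r)"
      using \<open>r > 1\<close> by (auto intro!: derivative_eq_intros)
    moreover have "1 / (r - 1) - 3 / r = 2 * r * ln_main_deriv 1 r"
      using \<open>r > 1\<close> by (simp add: ln_main_deriv_def divide_simps power2_eq_square)
    ultimately show ?thesis
      by (simp add: 1 ln_main_deriv_def[abs_def])
  next
    case 2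
    then show ?thesis
      using DERIV_ln_main_deriv_1[OF \<open>r > 1\<close>] by (simp add: numeral_2_eq_2)
  next
    case 3
    then show ?thesis
      using DERIV_ln_main_deriv_2[OF \<open>r > 1\<close>] by simp
  qed
qed

lemma DERIV_sqrt_deriv:
  assumes "m < 2" "r > 0"
  shows "(sqrt_deriv m has_real_derivative 2 * r * sqrt_deriv (Suc m) r) (at r)"
proof -
  consider "m = 0" | "m = 1"
    using \<open>m < 2\<close> by linarith
  then show ?thesis
    unfolding sqrt_deriv_def[abs_def] using \<open>r > 0\<close>
    by cases (auto intro!: derivative_eq_intros simp: divide_simps eval_nat_numeral)
qed

lemma third_forward_difference_ln_main_nonpos:
  assumes "s \<ge> (5 / 2)\<^sup>2" "a \<ge> 0"
  shows "(forward_difference a ^^ 3) (\<lambda>u. ln_main_deriv 0 (sqrt u)) s \<le> 0"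
proof (rule funpow_forward_difference_nonpos[where diff = "\<lambda>m u. ln_main_deriv m (sqrt u)"])
  fix u
  assume "u \<ge> s"
  with assms have "u > 1"
    by (simp add: power2_eq_square)
  then show "((\<lambda>u. ln_main_deriv m (sqrt u)) has_real_derivative
      ln_main_deriv (Suc m) (sqrt u)) (at u)"
    if "m < 3" for m
    using that by (intro DERIV_comp_sqrt DERIV_ln_main_deriv) auto
  define d where "d = sqrt u - 5 / 2"
  have "d \<ge> 0"
    unfolding d_def using \<open>u \<ge> s\<close> assms(1) real_le_rsqrt[of "5 / 2" u] by simp
  have r: "sqrt u = d + 5 / 2"
    by (simp add: d_def)
  have "16 * sqrt u ^ 3 - 63 * (sqrt u)\<^sup>2 + 69 * sqrt u - 24 =
      16 * d ^ 3 + 57 * d\<^sup>2 + 54 * d + 19 / 4"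
    unfolding r by (simp add: power3_eq_cube power2_eq_square algebra_simps)
  also have "\<dots> \<ge> 0"
    using \<open>d \<ge> 0\<close> by simp
  finally show "ln_main_deriv 3 (sqrt u) \<le> 0"
    unfolding ln_main_deriv_def using \<open>u > 1\<close> by (simp add: divide_nonpos_pos)
qed (use assms in simp)

lemma second_forward_difference_sqrt_add_ln_main_nonpos:
  assumes "s > 1" "a \<ge> 0"
  shows "(forward_difference a ^^ 2) (\<lambda>u. sqrt u + ln_main_deriv 0 (sqrt u)) s \<le> 0"
proof -
  have "(forward_difference a ^^ 2) (\<lambda>u. sqrt_deriv 0 (sqrt u) + ln_main_deriv 0 (sqrt u)) s \<le> 0"
  proof (rule funpow_forward_difference_nonpos
      [where diff = "\<lambda>m u. sqrt_deriv m (sqrt u) + ln_main_deriv m (sqrt u)"])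
    fix u
    assume "u \<ge> s"
    with assms have "sqrt u > 1"
      by simp
    then show "((\<lambda>u. sqrt_deriv m (sqrt u) + ln_main_deriv m (sqrt u)) has_real_derivative
        sqrt_deriv (Suc m) (sqrt u) + ln_main_deriv (Suc m) (sqrt u)) (at u)" if "m < 2" for m
      using that by (intro DERIV_add DERIV_comp_sqrt DERIV_sqrt_deriv DERIV_ln_main_deriv) auto
    have second_deriv: "sqrt_deriv 2 r + ln_main_deriv 2 r =
        - ((r - 2) ^ 3 + 2) / (4 * r ^ 4 * (r - 1)\<^sup>2)"
      if "r > 1" for r
      using that unfolding sqrt_deriv_def ln_main_deriv_def
      by (simp add: divide_simps) (simp add: algebra_simps eval_nat_numeral)
    have "(- 1) ^ 3 \<le> (sqrt u - 2) ^ 3"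
      using \<open>sqrt u > 1\<close> by (intro power_mono_odd) auto
    then show "sqrt_deriv 2 (sqrt u) + ln_main_deriv 2 (sqrt u) \<le> 0"
      using \<open>sqrt u > 1\<close> unfolding second_deriv[OF \<open>sqrt u > 1\<close>]
      by (intro divide_nonpos_pos) auto
  qed (use assms in simp)
  then show ?thesis
    by (simp add: sqrt_deriv_def)
qed

subsection \<open>Bounds for the partition function\<close>

text \<open>
  For large \<open>n\<close>, the partition number \<open>p(n)\<close> lies between the values of \<open>partition_bound (- 1)\<close> and
  \<open>partition_bound 1\<close> at \<open>\<mu>(n)\<close>, multiplied by \<open>\<pi>\<^sup>2 / (6 sqrt 3)\<close>.
\<close>

definition partition_bound :: "real \<Rightarrow> real \<Rightarrow> real" where
  "partition_bound c t = exp t * (t ^ 10 - t ^ 9 + c) / t ^ 12"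

definition partition_bound_ratio :: "real \<Rightarrow> real \<Rightarrow> real \<Rightarrow> real \<Rightarrow> real" where
  "partition_bound_ratio a c d s =
    partition_bound c (sqrt s) * partition_bound c (sqrt (s + 2 * a)) /
    (partition_bound d (sqrt (s + a)))\<^sup>2"

lemma power_Suc_diff_power_mono:
  fixes x t :: real
  assumes "1 \<le> x" "x \<le> t"
  shows "x ^ Suc n - x ^ n \<le> t ^ Suc n - t ^ n"
proof -
  have "x ^ n * (x - 1) \<le> t ^ n * (t - 1)"
    using assms by (intro mult_mono power_mono) auto
  then show ?thesis
    by (simp add: algebra_simps)
qed

lemma partition_bound_mono: "c \<le> d \<Longrightarrow> partition_bound c t \<le> partition_bound d t"
  by (simp add: partition_bound_def divide_right_mono)

lemma partition_bound_pos:
  assumes "t \<ge> 2" "c \<ge> - 1"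
  shows "partition_bound c t > 0"
proof -
  have "t ^ 10 - t ^ 9 > 1"
    using power_Suc_diff_power_mono[of 2 t 9] assms by simp
  then show ?thesis
    unfolding partition_bound_def using assms by simp
qed

lemma partition_bound_le_exp_mult:
  assumes "1 \<le> x" "x \<le> t" "b \<le> c" "c \<le> d" "x ^ 10 - x ^ 9 + b > 0"
  shows "partition_bound d t \<le> exp ((d - c) / (x ^ 10 - x ^ 9 + b)) * partition_bound c t"
proof -
  have le: "x ^ 10 - x ^ 9 + b \<le> t ^ 10 - t ^ 9 + c"
    using power_Suc_diff_power_mono[of x t 9] assms by simp
  have "(d - c) * (x ^ 10 - x ^ 9 + b) \<le> (d - c) * (t ^ 10 - t ^ 9 + c)"
    using le assms(4) by (intro mult_left_mono) auto
  then have "t ^ 10 - t ^ 9 + d \<le> (1 + (d - c) / (x ^ 10 - x ^ 9 + b)) * (t ^ 10 - t ^ 9 + c)"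
    using assms(5) by (simp add: field_simps)
  also have "\<dots> \<le> exp ((d - c) / (x ^ 10 - x ^ 9 + b)) * (t ^ 10 - t ^ 9 + c)"
    using le assms(5) by (intro mult_right_mono exp_ge_add_one_self) auto
  finally show ?thesis
    unfolding partition_bound_def
    by (simp add: divide_right_mono mult.left_commute)
qed

lemma ln_partition_bound_0:
  assumes "t > 1"
  shows "ln (partition_bound 0 t) = t + ln_main_deriv 0 t"
proof -
  have "partition_bound 0 t = exp t * (t - 1) / t ^ 3"
    using assms unfolding partition_bound_def
    by (simp add: divide_simps) (simp add: algebra_simps eval_nat_numeral)
  then show ?thesis
    using assms by (simp add: ln_main_deriv_def ln_div ln_mult ln_realpow)
qed

lemma partition_bound_ratio_0_le_1:
  assumes "s \<ge> 4" "a \<ge> 0"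
  shows "partition_bound_ratio a 0 0 s \<le> 1"
proof -
  define x y z where "x = sqrt s" and "y = sqrt (s + a)" and "z = sqrt (s + 2 * a)"
  have ge: "x \<ge> 2" "y \<ge> 2" "z \<ge> 2"
    unfolding x_def y_def z_def using assms by (auto intro!: real_le_rsqrt)
  have pos: "partition_bound 0 t > 0" if "t \<ge> 2" for t
    using that by (intro partition_bound_pos) auto
  have "(x + ln_main_deriv 0 x) + (z + ln_main_deriv 0 z) \<le> 2 * (y + ln_main_deriv 0 y)"
    using second_forward_difference_sqrt_add_ln_main_nonpos[of s a] assms
    by (simp add: second_forward_difference x_def y_def z_def)
  then have "ln (partition_bound 0 x * partition_bound 0 z) \<le> ln ((partition_bound 0 y)\<^sup>2)"
    using ge pos by (simp add: ln_mult_pos ln_realpow ln_partition_bound_0)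
  then have "partition_bound 0 x * partition_bound 0 z \<le> (partition_bound 0 y)\<^sup>2"
    using ge[THEN pos] by (subst (asm) ln_le_cancel_iff) auto
  then show ?thesis
    using ge[THEN pos] by (simp add: partition_bound_ratio_def x_def y_def z_def divide_le_eq)
qed

lemma partition_bound_ratio_le_1:
  assumes "s \<ge> 4" "a \<ge> 0"
  shows "partition_bound_ratio a (- 1) 1 s \<le> 1"
proof -
  have pos: "partition_bound c (sqrt u) > 0" if "u \<ge> s" "c \<ge> - 1" for c u
    using that assms by (intro partition_bound_pos real_le_rsqrt) auto
  have "partition_bound_ratio a (- 1) 1 s \<le> partition_bound_ratio a 0 0 s"
    unfolding partition_bound_ratio_def using assms
    by (intro frac_le mult_mono power_mono partition_bound_mono zero_less_power mult_nonneg_nonneg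
        less_imp_le[OF pos] pos) auto
  also have "\<dots> \<le> 1"
    using assms by (rule partition_bound_ratio_0_le_1)
  finally show ?thesis .
qed

lemma partition_bound_ratio_pos:
  assumes "s \<ge> 4" "a \<ge> 0" "c \<ge> - 1" "d \<ge> - 1"
  shows "partition_bound_ratio a c d s > 0"
  unfolding partition_bound_ratio_def using assms
  by (intro divide_pos_pos mult_pos_pos zero_less_power partition_bound_pos real_le_rsqrt) auto

lemma partition_bound_0_third_ratio_le:
  fixes s a :: real
  assumes "s \<ge> (5 / 2)\<^sup>2" "a \<ge> 0"
  defines "B \<equiv> \<lambda>j. partition_bound 0 (sqrt (s + j * a))"
  shows "B 1 ^ 3 * B 3 \<le> exp ((forward_difference a ^^ 3) sqrt s) * (B 2 ^ 3 * B 0)"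
proof -
  have ge: "sqrt (s + j * a) \<ge> 5 / 2" if "j \<ge> 0" for j
    using assms(1) mult_nonneg_nonneg[OF that \<open>a \<ge> 0\<close>] by (intro real_le_rsqrt) simp
  have pos: "B j > 0" if "j \<ge> 0" for j
    unfolding B_def using ge[OF that] by (intro partition_bound_pos) auto
  have ln_B: "ln (B j) = sqrt (s + j * a) + ln_main_deriv 0 (sqrt (s + j * a))" if "j \<ge> 0" for j
    unfolding B_def using ge[OF that] by (intro ln_partition_bound_0) linarith
  have "3 * ln (B 1) + ln (B 3) \<le> (forward_difference a ^^ 3) sqrt s + (3 * ln (B 2) + ln (B 0))"
    using third_forward_difference_ln_main_nonpos[OF assms(1,2)]
    by (simp add: ln_B third_forward_difference)
  then have "ln (B 1 ^ 3 * B 3) \<le> ln (exp ((forward_difference a ^^ 3) sqrt s) * (B 2 ^ 3 * B 0))"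
    using pos by (simp add: ln_mult_pos ln_realpow)
  then show ?thesis
    using pos by (subst (asm) ln_le_cancel_iff) auto
qed

lemma partition_bound_third_ratio_le:
  fixes s a :: real
  assumes "s \<ge> (5 / 2)\<^sup>2" "a \<ge> 0"
  defines "x \<equiv> sqrt s" and "B \<equiv> \<lambda>c j. partition_bound c (sqrt (s + j * a))"
  shows "B 1 1 ^ 3 * B 1 3 \<le>
    exp ((forward_difference a ^^ 3) sqrt s + 8 / (x ^ 10 - x ^ 9 - 1)) * (B (- 1) 2 ^ 3 * B (- 1) 0)"
proof -
  define E where "E = exp ((forward_difference a ^^ 3) sqrt s)"
  define p where "p = 1 / (x ^ 10 - x ^ 9 - 1)"
  have x: "x \<ge> 5 / 2"
    unfolding x_def using assms(1) by (intro real_le_rsqrt)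
  have x_le: "x \<le> sqrt (s + j * a)" if "j \<ge> 0" for j
    unfolding x_def using that assms(2) by simp
  have power_diff: "x ^ 10 - x ^ 9 > 1"
    using power_Suc_diff_power_mono[of 2 x 9] x by simp
  have nonneg: "B c j \<ge> 0" if "j \<ge> 0" "c \<ge> - 1" for c j
    unfolding B_def using that x x_le[of j] by (intro less_imp_le[OF partition_bound_pos]) auto
  have le_exp: "B d j \<le> exp p * B c j" if "j \<ge> 0" "c \<ge> - 1" "d = c + 1" for c d j
    unfolding B_def p_def
    using partition_bound_le_exp_mult[of x "sqrt (s + j * a)" "- 1" c d] that x x_le power_diff
    by simp
  have "B 1 1 ^ 3 * B 1 3 \<le> (exp p * B 0 1) ^ 3 * (exp p * B 0 3)"
    by (intro mult_mono power_mono le_exp) (simp_all add: nonneg)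
  also have "\<dots> = exp (4 * p) * (B 0 1 ^ 3 * B 0 3)"
    by (simp add: power_mult_distrib mult_ac flip: exp_add exp_of_nat_mult)
  also have "\<dots> \<le> exp (4 * p) * (E * (B 0 2 ^ 3 * B 0 0))"
    using partition_bound_0_third_ratio_le[OF assms(1,2)] by (simp add: B_def E_def)
  also have "\<dots> \<le> exp (4 * p) * (E * ((exp p * B (- 1) 2) ^ 3 * (exp p * B (- 1) 0)))"
    by (intro mult_left_mono mult_mono power_mono le_exp) (simp_all add: E_def nonneg)
  also have "\<dots> = E * exp (8 * p) * (B (- 1) 2 ^ 3 * B (- 1) 0)"
    by (simp add: power_mult_distrib mult_ac flip: exp_add exp_of_nat_mult)
  finally show ?thesis
    by (simp add: E_def p_def exp_add)
qed

lemma partition_bound_ratio_shift_le: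
  fixes s a :: real
  assumes "s \<ge> (5 / 2)\<^sup>2" "a \<ge> 0"
  defines "x \<equiv> sqrt s"
  shows "partition_bound_ratio a 1 (- 1) (s + a) \<le>
    exp ((forward_difference a ^^ 3) sqrt s + 8 / (x ^ 10 - x ^ 9 - 1)) *
    partition_bound_ratio a (- 1) 1 s"
proof -
  define y z w where "y = sqrt (s + a)" and "z = sqrt (s + 2 * a)" and "w = sqrt (s + 3 * a)"
  define E where "E = exp ((forward_difference a ^^ 3) sqrt s + 8 / (x ^ 10 - x ^ 9 - 1))"
  have "s \<ge> 4"
    using assms(1) by (simp add: power2_eq_square)
  then have pos: "partition_bound 1 y > 0" "partition_bound (- 1) z > 0"
    unfolding y_def z_def using assms(2) by (auto intro!: partition_bound_pos real_le_rsqrt)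
  have "partition_bound 1 y ^ 3 * partition_bound 1 w \<le>
      E * (partition_bound (- 1) z ^ 3 * partition_bound (- 1) x)"
    using partition_bound_third_ratio_le[OF assms(1,2)]
    by (simp add: E_def x_def y_def z_def w_def)
  then have "partition_bound 1 y * partition_bound 1 w / (partition_bound (- 1) z)\<^sup>2 \<le>
      E * (partition_bound (- 1) x * partition_bound (- 1) z / (partition_bound 1 y)\<^sup>2)"
    using pos by (simp add: field_simps power2_eq_square power3_eq_cube)
  moreover have "s + a + 2 * a = s + 3 * a" "s + a + a = s + 2 * a" by simp_all
  ultimately show ?thesis
    unfolding partition_bound_ratio_def E_def x_def y_def z_def w_def by (simp only:)
qed

subsection \<open>The functions \<open>f\<close> and \<open>g\<close>\<close>

lemma mu_squared:
  assumes "m \<ge> 1"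
  shows "(mu m)\<^sup>2 = (pi / 6)\<^sup>2 * (24 * real_of_int m - 1)"
  using assms by (simp add: mu_def power_mult_distrib power_divide)

lemma mu_add:
  assumes "m \<ge> 1"
  shows "mu (m + k) = sqrt ((mu m)\<^sup>2 + real_of_int k * (2 * pi\<^sup>2 / 3))"
proof -
  have "(mu m)\<^sup>2 + real_of_int k * (2 * pi\<^sup>2 / 3) = (pi / 6)\<^sup>2 * (24 * real_of_int (m + k) - 1)"
    unfolding mu_squared[OF assms] by (simp add: field_simps power2_eq_square)
  then show ?thesis
    by (simp add: mu_def real_sqrt_mult)
qed

lemma mu_ge:
  assumes "m \<ge> 1"
  shows "mu m \<ge> 5 / 2"
proof -
  have "(5 / 2)\<^sup>2 \<le> (3.14 / 6)\<^sup>2 * (24 * real_of_int m - 1)"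
    using assms by (simp add: power2_eq_square)
  also have "\<dots> \<le> (pi / 6)\<^sup>2 * (24 * real_of_int m - 1)"
    using assms pi_approx(1) by (intro mult_right_mono power_mono) auto
  also have "\<dots> = (mu m)\<^sup>2"
    using mu_squared[OF assms] by simp
  finally show ?thesis
    by (rule power2_le_imp_le) (use assms in \<open>simp add: mu_def\<close>)
qed

lemma exp_second_difference: "exp (x - 2 * y + z) = exp x * exp z / (exp y)\<^sup>2" for x y z :: real
  by (simp add: exp_add exp_diff exp_double)

lemma partition_bound_ratio_mu:
  fixes n :: int
  assumes "n \<ge> 2"
  defines "x \<equiv> mu (n - 1)" and "y \<equiv> mu n" and "z \<equiv> mu (n + 1)"
  shows "partition_bound_ratio (2 * pi\<^sup>2 / 3) c d (x\<^sup>2) =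
    exp (x - 2 * y + z) * (((x ^ 10 - x ^ 9 + c) * y ^ 24 * (z ^ 10 - z ^ 9 + c)) /
      (x ^ 12 * (y ^ 10 - y ^ 9 + d)\<^sup>2 * z ^ 12))"
proof -
  have "sqrt (x\<^sup>2) = x" "sqrt (x\<^sup>2 + 2 * pi\<^sup>2 / 3) = y" "sqrt (x\<^sup>2 + 2 * (2 * pi\<^sup>2 / 3)) = z"
    using mu_add[of "n - 1" 0] mu_add[of "n - 1" 1] mu_add[of "n - 1" 2] assms
    by (simp_all add: add.commute)
  then show ?thesis
    unfolding partition_bound_ratio_def partition_bound_def exp_second_difference
    by (simp add: power_divide power_mult_distrib mult_ac flip: power_mult)
qed

lemma f_eq_partition_bound_ratio:
  "n \<ge> 2 \<Longrightarrow> f n = partition_bound_ratio (2 * pi\<^sup>2 / 3) (- 1) 1 ((mu (n - 1))\<^sup>2)"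
  by (simp add: partition_bound_ratio_mu f_def Let_def)

lemma g_eq_partition_bound_ratio:
  "n \<ge> 2 \<Longrightarrow> g n = partition_bound_ratio (2 * pi\<^sup>2 / 3) 1 (- 1) ((mu (n - 1))\<^sup>2)"
  by (simp add: partition_bound_ratio_mu g_def Let_def)

lemma third_forward_difference_sqrt_less:
  assumes "x \<ge> 5 / 2"
  shows "(forward_difference (2 * pi\<^sup>2 / 3) ^^ 3) sqrt (x\<^sup>2) < 107 / (x ^ 5 + 110)"
proof -
  have "pi ^ 6 \<le> 3.1416 ^ 6"
    using pi_approx(2) by (intro power_mono) auto
  then have pi_power6: "pi ^ 6 / 9 < 107"
    by (simp add: eval_nat_numeral)
  have "110 \<le> 2 * 3\<^sup>2 * (5 / 2 :: real) ^ 3"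
    by (simp add: eval_nat_numeral)
  also have "\<dots> \<le> 2 * pi\<^sup>2 * x ^ 3"
    using pi_gt3 assms by (intro mult_mono power_mono) auto
  finally have "x ^ 5 + 110 \<le> x ^ 5 + 2 * pi\<^sup>2 * x ^ 3"
    by simp
  have "(forward_difference (2 * pi\<^sup>2 / 3) ^^ 3) sqrt (x\<^sup>2) \<le>
      3 / 8 * (2 * pi\<^sup>2 / 3) ^ 3 / (x ^ 5 + 3 * (2 * pi\<^sup>2 / 3) * x ^ 3)"
    using third_forward_difference_sqrt_le[of "x\<^sup>2" "2 * pi\<^sup>2 / 3"] assms by simp
  also have "\<dots> = (pi ^ 6 / 9) / (x ^ 5 + 2 * pi\<^sup>2 * x ^ 3)"
    by (simp add: power_divide power_mult_distrib flip: power_mult)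
  also have "\<dots> < 107 / (x ^ 5 + 110)"
    using pi_power6 \<open>x ^ 5 + 110 \<le> x ^ 5 + 2 * pi\<^sup>2 * x ^ 3\<close> assms
    by (intro frac_less) (auto intro: add_nonneg_pos)
  finally show ?thesis .
qed

lemma third_ratio_correction_le:
  fixes x :: real
  assumes "x \<ge> 5 / 2"
  shows "8 / (x ^ 10 - x ^ 9 - 1) \<le> 3 / (x ^ 5 + 110)"
proof -
  have "(5 / 2) ^ 5 \<le> x ^ 5"
    using assms by (intro power_mono) auto
  then have x_power5: "97 \<le> x ^ 5"
    by (simp add: power_divide)
  have "(5 / 2) ^ 4 * (5 / 2 - 1) \<le> x ^ 4 * (x - 1)"
    using assms by (intro mult_mono power_mono) auto
  then have "58 \<le> x ^ 4 * (x - 1)"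
    by (simp add: power_divide)
  then have "58 * x ^ 5 \<le> x ^ 4 * (x - 1) * x ^ 5"
    using assms by (intro mult_right_mono) auto
  also have "\<dots> = x ^ 10 - x ^ 9"
    by (simp add: algebra_simps eval_nat_numeral)
  finally show ?thesis
    using x_power5 by (simp add: divide_simps)
qed

lemma exp_less_one_plus:
  fixes t h :: real
  assumes "h > - 1" "t < h / (1 + h)"
  shows "exp t < 1 + h"
proof -
  have "1 / (1 + h) < 1 - t"
    using assms by (simp add: field_simps)
  also have "\<dots> \<le> exp (- t)"
    using exp_ge_add_one_self[of "- t"] by simp
  finally show ?thesis
    using assms(1) by (simp add: exp_minus field_simps)
qed

lemma exp_third_forward_difference_sqrt_less:
  assumes "x \<ge> 5 / 2"
  shows "exp ((forward_difference (2 * pi\<^sup>2 / 3) ^^ 3) sqrt (x\<^sup>2) + 8 / (x ^ 10 - x ^ 9 - 1)) <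
      1 + 110 / x ^ 5"
    (is "exp ?t < _")
proof (rule exp_less_one_plus)
  have "x ^ 5 > 0"
    using assms by simp
  then have "110 / x ^ 5 > 0"
    by simp
  then show "110 / x ^ 5 > - 1"
    by linarith
  have "?t < 107 / (x ^ 5 + 110) + 3 / (x ^ 5 + 110)"
    using third_forward_difference_sqrt_less[OF assms] third_ratio_correction_le[OF assms] by simp
  also have "\<dots> = 110 / x ^ 5 / (1 + 110 / x ^ 5)"
    using \<open>x ^ 5 > 0\<close> by (simp add: field_simps)
  finally show "?t < 110 / x ^ 5 / (1 + 110 / x ^ 5)" .
qed

theorem theorem3p1:
  fixes n :: int
  assumes "n \<ge> 2"
  shows "g (n + 1) < f n + 110 / mu (n - 1) ^ 5"
proof -
  define x where "x = mu (n - 1)"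
  define t where
    "t = (forward_difference (2 * pi\<^sup>2 / 3) ^^ 3) sqrt (x\<^sup>2) + 8 / (x ^ 10 - x ^ 9 - 1)"
  have x: "x \<ge> 5 / 2"
    unfolding x_def using assms by (intro mu_ge) simp
  then have x_sq: "x\<^sup>2 \<ge> (5 / 2)\<^sup>2"
    by (intro power_mono) auto
  then have f_bounds: "0 < f n" "f n \<le> 1"
    unfolding f_eq_partition_bound_ratio[OF assms, folded x_def]
    by (auto intro!: partition_bound_ratio_pos partition_bound_ratio_le_1 simp: power2_eq_square)
  have "(mu n)\<^sup>2 = x\<^sup>2 + 2 * pi\<^sup>2 / 3"
    using mu_squared[of n] mu_squared[of "n - 1"] assms
    by (simp add: x_def field_simps power2_eq_square)
  then have "g (n + 1) \<le> exp t * f n"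
    using partition_bound_ratio_shift_le[OF x_sq, of "2 * pi\<^sup>2 / 3"] x assms
    by (simp add: t_def f_eq_partition_bound_ratio g_eq_partition_bound_ratio flip: x_def)
  also have "\<dots> < (1 + 110 / x ^ 5) * f n"
    unfolding t_def using exp_third_forward_difference_sqrt_less[OF x] f_bounds(1)
    by (rule mult_strict_right_mono)
  also have "\<dots> \<le> f n + 110 / x ^ 5"
    using x f_bounds(2) mult_left_le[of "f n" "110 / x ^ 5"] by (simp add: distrib_right)
  finally show ?thesis
    by (simp add: x_def)
qed

end
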